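(* Let $a,b\in\mathbb{R}$ with $a<b$, and let $f:\mathbb{R}\to\mathbb{R}_+$ be such that $f\in C^2(a,b)\cap C[a,b]$ and $f$ has a unique global minimizer $x_*\in(a,b)$ (over $[a,b]$), with $f'(x_* )=0$ and $f''(x_* )\neq 0$. Let $\lambda>0$ and let $x^1_0,x^2_0\in\mathbb{R}$ satisfy $x_*\in(x^1_0,x^2_0)\subset[a,b]$. For each $\alpha>0$ consider a classical solution $(x^1_t,x^2_t)_{t\ge 0}$ of the consensus based optimization system with $N=2$ particles, parameters $\lambda,\alpha$, objective function $f$ and initial data $(x^1_0,x^2_0)$. Then there is a point $x_\infty=x_\infty(\alpha)\in\mathbb{R}$ such that $x^1_t\to x_\infty$ and $x^2_t\to x_\infty$ as $t\to\infty$. Moreover, there exist $\alpha_1>0$ and a constant $c>0$ independent of $\alpha$ such that $$|x_\infty-x_*|\le \frac{c}{\sqrt{\alpha}}\qquad\text{for all }\alpha>\alpha_1 .$$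
   Context: Consensus based optimization system: for $N$ particles with positions $x^i_t\in\mathbb{R}$, parameters $\lambda>0$ and $\alpha>0$, and objective function $f$, it is the ODE system $$\frac{dx^i_t}{dt}=-\lambda(x^i_t-m_t),\quad i=1,\dots,N,\ t>0,\qquad m_t=\sum_{i=1}^N x^i_t\psi^i_t,\qquad \psi^i_t=\frac{\omega_f^\alpha(x^i_t)}{\sum_{k=1}^N\omega_f^\alpha(x^k_t)},$$ where $\omega_f^\alpha(x)=\exp(-\alpha f(x))$, with given initial positions $x^i_0$. A classical solution means a continuously differentiable function of $t$ satisfying the system with the given initial data. For $N=2$ the system reads $(x^1_t)'=\lambda\psi^2_t(x^2_t-x^1_t)$, $(x^2_t)'=\lambda\psi^1_t(x^1_t-x^2_t)$. *)

theory Defs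
  imports "HOL-Analysis.Analysis"
begin

text \<open>Only meaningful for open \<open>S\<close>, since \<open>deriv\<close> is the two-sided derivative.\<close>

definition C2_on :: "real set \<Rightarrow> (real \<Rightarrow> real) \<Rightarrow> bool" where
  "C2_on S f \<longleftrightarrow>
     f differentiable_on S \<and> deriv f differentiable_on S \<and> continuous_on S (deriv (deriv f))"

text \<open>
  A configuration of \<open>N\<close> particles is a function \<open>x :: nat \<Rightarrow> real\<close> of which only the values at
  the indices \<open>1, \<dots>, N\<close> matter; a trajectory is \<open>X :: nat \<Rightarrow> real \<Rightarrow> real\<close>, with \<open>X i t\<close> the
  position of particle \<open>i\<close> at time \<open>t\<close>.
\<close>

definition cbo_weight :: "(real \<Rightarrow> real) \<Rightarrow> real \<Rightarrow> real \<Rightarrow> real" where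
  "cbo_weight f \<alpha> x = exp (- \<alpha> * f x)"

definition cbo_psi :: "(real \<Rightarrow> real) \<Rightarrow> real \<Rightarrow> nat \<Rightarrow> (nat \<Rightarrow> real) \<Rightarrow> nat \<Rightarrow> real" where
  "cbo_psi f \<alpha> N x i = cbo_weight f \<alpha> (x i) / (\<Sum>k=1..N. cbo_weight f \<alpha> (x k))"

definition cbo_mean :: "(real \<Rightarrow> real) \<Rightarrow> real \<Rightarrow> nat \<Rightarrow> (nat \<Rightarrow> real) \<Rightarrow> real" where
  "cbo_mean f \<alpha> N x = (\<Sum>i=1..N. x i * cbo_psi f \<alpha> N x i)"

text \<open>
  Classical solutions are continuously differentiable on \<open>[0, \<infinity>)\<close>, with the one-sided derivative
  at \<open>0\<close>; the differential equation is imposed for \<open>t > 0\<close>.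
\<close>

definition cbo_solution ::
  "real \<Rightarrow> real \<Rightarrow> (real \<Rightarrow> real) \<Rightarrow> nat \<Rightarrow> (nat \<Rightarrow> real) \<Rightarrow> (nat \<Rightarrow> real \<Rightarrow> real) \<Rightarrow> bool" where
  "cbo_solution lam \<alpha> f N x0 X \<longleftrightarrow>
     (\<forall>i\<in>{1..N}. X i 0 = x0 i \<and>
        (\<exists>D. continuous_on {0..} D \<and>
             (\<forall>t\<ge>0. (X i has_real_derivative D t) (at t within {0..})) \<and>
             (\<forall>t>0. D t = - lam * (X i t - cbo_mean f \<alpha> N (\<lambda>k. X k t)))))"

end

theory Submission
  imports Defs
begin

text \<open>
  With two particles the dynamics hides a conserved quantity. The gap between the particles solves
  \<open>d' = - lam * d\<close>, so it decays exponentially without changing sign; the left particle moves to the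
  right, the right one to the left, and both tend to the same point. Moreover, writing
  \<open>w = exp (- \<alpha> f)\<close>, the velocities satisfy \<open>w(x1) x1' + w(x2) x2' = 0\<close>, so that the sum
  \<open>W(x1) + W(x2)\<close> is constant for any antiderivative \<open>W\<close> of \<open>w\<close>. In the limit
  \<open>2 W(x_inf) = W(x1(0)) + W(x2(0))\<close>: the consensus point is exactly the median of the Gibbs weight
  \<open>w\<close> on the initial interval (lemma \<open>consensus_at_gibbs_median\<close>).

  It remains to locate this median for large \<open>\<alpha>\<close>. Nondegeneracy of the minimiser squeezes
  \<open>f - f x_star\<close> between two multiples of \<open>(x - x_star)\<^sup>2\<close>, the lower one on the whole interval
  by compactness and the upper one near \<open>x_star\<close> (lemma \<open>quadratic_growth\<close>). Up to the factor
  \<open>exp (- \<alpha> f x_star)\<close>, the mass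
  of \<open>w\<close> within distance \<open>1 / sqrt \<alpha>\<close> of \<open>x_star\<close>, on either side, is at least a constant times
  \<open>1 / sqrt \<alpha>\<close>, whereas the inequality \<open>exp (- u) \<le> 1 / u\<close> bounds the mass at distance more
  than \<open>s\<close> on one side by a constant times \<open>1 / (\<alpha> s)\<close>. If the median has distance \<open>s\<close> from
  \<open>x_star\<close>, the two halves of the mass balance only if \<open>1 / (\<alpha> s)\<close> is at least a constant times
  \<open>1 / sqrt \<alpha>\<close> (lemma \<open>median_upper_bound\<close> and its mirror image).
\<close>

section \<open>The two-particle dynamics\<close>

text \<open>The mean is a convex combination of the two positions, so each particle is attracted by the
  other one with a rate given by the other's weight.\<close>

lemma cbo_two_particle_velocities:
  assumes sol: "cbo_solution lam \<alpha> f 2 x0 X" and t: "t > 0"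
  defines "w \<equiv> cbo_weight f \<alpha>"
  shows "(X 1 has_real_derivative
            lam * (w (X 2 t) / (w (X 1 t) + w (X 2 t))) * (X 2 t - X 1 t)) (at t)"
    and "(X 2 has_real_derivative
            - lam * (w (X 1 t) / (w (X 1 t) + w (X 2 t))) * (X 2 t - X 1 t)) (at t)"
proof -
  have pos: "w (X 1 t) + w (X 2 t) > 0"
    by (simp add: w_def cbo_weight_def add_pos_pos)
  have two: "{1..2::nat} = {1, 2}" by auto
  have mean: "cbo_mean f \<alpha> 2 (\<lambda>k. X k t) =
      (X 1 t * w (X 1 t) + X 2 t * w (X 2 t)) / (w (X 1 t) + w (X 2 t))"
    by (simp add: cbo_mean_def cbo_psi_def two w_def add_divide_distrib del: One_nat_def)
  have der: "(X i has_real_derivative - lam * (X i t - cbo_mean f \<alpha> 2 (\<lambda>k. X k t))) (at t)"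
    if "i \<in> {1..2}" for i
  proof -
    obtain D where D: "\<forall>t\<ge>0. (X i has_real_derivative D t) (at t within {0..})"
        "\<forall>t>0. D t = - lam * (X i t - cbo_mean f \<alpha> 2 (\<lambda>k. X k t))"
      using sol \<open>i \<in> {1..2}\<close> unfolding cbo_solution_def by blast
    have "at t within {0..} = at t"
      using t by (intro at_within_interior) auto
    then show ?thesis using D t by (metis less_imp_le)
  qed
  have "- lam * (X 1 t - cbo_mean f \<alpha> 2 (\<lambda>k. X k t)) =
      lam * (w (X 2 t) / (w (X 1 t) + w (X 2 t))) * (X 2 t - X 1 t)"
    unfolding mean using pos by (simp add: field_simps)
  then show "(X 1 has_real_derivative
      lam * (w (X 2 t) / (w (X 1 t) + w (X 2 t))) * (X 2 t - X 1 t)) (at t)"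
    using der[of 1] by simp
  have "- lam * (X 2 t - cbo_mean f \<alpha> 2 (\<lambda>k. X k t)) =
      - lam * (w (X 1 t) / (w (X 1 t) + w (X 2 t))) * (X 2 t - X 1 t)"
    unfolding mean using pos by (simp add: field_simps)
  then show "(X 2 has_real_derivative
      - lam * (w (X 1 t) / (w (X 1 t) + w (X 2 t))) * (X 2 t - X 1 t)) (at t)"
    using der[of 2] by simp
qed

lemma cbo_solution_continuous:
  assumes "cbo_solution lam \<alpha> f N x0 X" "i \<in> {1..N}"
  shows "continuous_on {0..} (X i)"
  using assms unfolding cbo_solution_def
  by (metis DERIV_continuous_on atLeast_iff)

lemma cbo_two_particle_gap:
  assumes sol: "cbo_solution lam \<alpha> f 2 x0 X" and t: "t \<ge> 0"
  shows "X 2 t - X 1 t = (x0 2 - x0 1) * exp (- lam * t)"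
proof (cases "t = 0")
  case True
  then show ?thesis using sol by (simp add: cbo_solution_def)
next
  case False
  have init: "X 1 0 = x0 1" "X 2 0 = x0 2"
    using sol by (simp_all add: cbo_solution_def)
  let ?g = "\<lambda>s. (X 2 s - X 1 s) * exp (lam * s)"
  have "continuous_on {0..} ?g"
    by (intro continuous_intros cbo_solution_continuous[OF sol]) auto
  then have cont: "continuous_on {0..t} ?g"
    by (rule continuous_on_subset) auto
  have der: "(?g has_real_derivative 0) (at s)" if "0 < s" for s
  proof -
    define w1 w2 where w: "w1 = cbo_weight f \<alpha> (X 1 s)" "w2 = cbo_weight f \<alpha> (X 2 s)"
    have "w1 + w2 > 0" by (simp add: w cbo_weight_def add_pos_pos)
    then have one: "w1 / (w1 + w2) = 1 - w2 / (w1 + w2)" by (simp add: field_simps)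
    show ?thesis
      by (rule derivative_eq_intros cbo_two_particle_velocities[OF sol that] refl)+
        (simp add: w[symmetric] one algebra_simps del: One_nat_def)
  qed
  have "?g t = ?g 0"
    using DERIV_isconst_end[OF _ cont] der t False by auto
  then have "(X 2 t - X 1 t) * exp (lam * t) = x0 2 - x0 1"
    by (simp add: init del: One_nat_def)
  then show ?thesis
    by (metis exp_minus_inverse minus_mult_left mult.assoc mult.right_neutral)
qed

lemma cbo_two_particle_monotone:
  assumes sol: "cbo_solution lam \<alpha> f 2 x0 X" and lam: "lam > 0" and less: "x0 1 < x0 2"
    and st: "0 \<le> s" "s \<le> t"
  shows "X 1 s \<le> X 1 t" and "X 2 t \<le> X 2 s"
proof -
  have gap: "X 2 r - X 1 r \<ge> 0" if "r \<ge> 0" for r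
    using cbo_two_particle_gap[OF sol that] less by simp
  have wpos: "cbo_weight f \<alpha> x / (cbo_weight f \<alpha> y + cbo_weight f \<alpha> z) \<ge> 0" for x y z
    by (simp add: cbo_weight_def add_nonneg_nonneg)
  have cont: "continuous_on {s..t} (X i)" if "i \<in> {1..2}" for i
    by (rule continuous_on_subset[OF cbo_solution_continuous[OF sol that]]) (use st in auto)
  show "X 1 s \<le> X 1 t"
  proof (rule DERIV_nonneg_imp_increasing_open[OF st(2) _ cont])
    fix r assume "s < r" "r < t"
    then have "r > 0" using st by simp
    show "\<exists>y. (X 1 has_real_derivative y) (at r) \<and> 0 \<le> y"
      by (intro exI conjI, rule cbo_two_particle_velocities(1)[OF sol \<open>r > 0\<close>])
        (use gap[of r] wpos lam \<open>r > 0\<close> in \<open>intro mult_nonneg_nonneg; simp\<close>)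
  qed simp
  show "X 2 t \<le> X 2 s"
  proof (rule DERIV_nonpos_imp_decreasing_open[OF st(2) _ cont])
    fix r assume "s < r" "r < t"
    then have "r > 0" using st by simp
    let ?p = "cbo_weight f \<alpha> (X 1 r) / (cbo_weight f \<alpha> (X 1 r) + cbo_weight f \<alpha> (X 2 r))"
    have "0 \<le> lam * ?p * (X 2 r - X 1 r)"
      using gap[of r] wpos lam \<open>r > 0\<close> by (intro mult_nonneg_nonneg; simp)
    then have "- lam * ?p * (X 2 r - X 1 r) \<le> 0" by simp
    then show "\<exists>y. (X 2 has_real_derivative y) (at r) \<and> y \<le> 0"
      using cbo_two_particle_velocities(2)[OF sol \<open>r > 0\<close>] by blast
  qed simp
qed

lemma cbo_two_particle_range:
  assumes sol: "cbo_solution lam \<alpha> f 2 x0 X" and lam: "lam > 0" and less: "x0 1 < x0 2"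
    and t: "t \<ge> 0"
  shows "X 1 t \<in> {x0 1..x0 2}" and "X 2 t \<in> {x0 1..x0 2}"
proof -
  have "X 1 0 = x0 1" "X 2 0 = x0 2" using sol by (simp_all add: cbo_solution_def)
  moreover have "X 2 t - X 1 t \<ge> 0" using cbo_two_particle_gap[OF sol t] less by simp
  ultimately show "X 1 t \<in> {x0 1..x0 2}" "X 2 t \<in> {x0 1..x0 2}"
    using cbo_two_particle_monotone[OF sol lam less order_refl t] by auto
qed

lemma cbo_two_particle_consensus:
  assumes sol: "cbo_solution lam \<alpha> f 2 x0 X" and lam: "lam > 0" and less: "x0 1 < x0 2"
  obtains m where "(X 1 \<longlongrightarrow> m) at_top" "(X 2 \<longlongrightarrow> m) at_top" "m \<in> {x0 1..x0 2}"
proof -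
  note range = cbo_two_particle_range[OF sol lam less]
  define m where "m = (SUP t\<in>{0..}. X 1 t)"
  have bdd: "bdd_above (X 1 ` {0..})"
    using range(1) by (intro bdd_aboveI[of _ "x0 2"]) auto
  have lim1: "(X 1 \<longlongrightarrow> m) at_top"
  proof (rule increasing_tendsto)
    show "\<forall>\<^sub>F t in at_top. X 1 t \<le> m"
      using eventually_ge_at_top[of 0]
      by eventually_elim (use bdd in \<open>auto simp: m_def intro!: cSUP_upper\<close>)
    fix y assume "y < m"
    then obtain s where s: "s \<ge> 0" "y < X 1 s"
      unfolding m_def using less_cSUP_iff[OF _ bdd] by auto
    show "\<forall>\<^sub>F t in at_top. y < X 1 t"
      using eventually_ge_at_top[of s]
      by eventually_elim
        (use s cbo_two_particle_monotone(1)[OF sol lam less] in \<open>force intro: less_le_trans\<close>)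
  qed
  have "((\<lambda>t. exp (- lam * t)) \<longlongrightarrow> 0) at_top"
    using lam by (intro filterlim_compose[OF exp_at_bot] filterlim_tendsto_neg_mult_at_bot[OF
          tendsto_const _ filterlim_ident]) auto
  then have "((\<lambda>t. X 1 t + (x0 2 - x0 1) * exp (- lam * t)) \<longlongrightarrow> m + (x0 2 - x0 1) * 0) at_top"
    by (intro tendsto_intros lim1)
  moreover have "\<forall>\<^sub>F t in at_top. X 1 t + (x0 2 - x0 1) * exp (- lam * t) = X 2 t"
    using eventually_ge_at_top[of 0]
    by eventually_elim (use cbo_two_particle_gap[OF sol] in \<open>force simp: algebra_simps\<close>)
  ultimately have lim2: "(X 2 \<longlongrightarrow> m) at_top"
    by (simp add: tendsto_cong)
  have "\<forall>\<^sub>F t in at_top. X 1 t \<in> {x0 1..x0 2}"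
    using eventually_ge_at_top[of 0] by eventually_elim (rule range(1))
  then have "m \<in> {x0 1..x0 2}"
    by (intro Lim_in_closed_set[OF _ _ _ lim1]) auto
  with lim1 lim2 show thesis by (rule that)
qed

text \<open>Along the dynamics \<open>w(x1) x1' = lam w(x1) w(x2) (x2 - x1) / (w(x1) + w(x2)) = - w(x2) x2'\<close>:
  the two particles sweep equal amounts of Gibbs mass in opposite directions. They meet where these
  amounts exhaust the initial interval, which is the median.\<close>

lemma consensus_at_gibbs_median:
  assumes sol: "cbo_solution lam \<alpha> f 2 x0 X" and lam: "lam > 0" and less: "x0 1 < x0 2"
    and cont: "continuous_on {x0 1..x0 2} f"
    and lim: "(X 1 \<longlongrightarrow> m) at_top" "(X 2 \<longlongrightarrow> m) at_top" and m: "m \<in> {x0 1..x0 2}"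
  shows "integral {x0 1..m} (cbo_weight f \<alpha>) = integral {m..x0 2} (cbo_weight f \<alpha>)"
proof -
  define w where "w = cbo_weight f \<alpha>"
  define W where "W y = integral {x0 1..y} w" for y
  note range = cbo_two_particle_range[OF sol lam less]
  have init: "X 1 0 = x0 1" "X 2 0 = x0 2"
    using sol by (simp_all add: cbo_solution_def)
  have wcont: "continuous_on {x0 1..x0 2} w"
    unfolding w_def cbo_weight_def[abs_def] by (intro continuous_intros cont)
  have Wder: "(W has_real_derivative w y) (at y within {x0 1..x0 2})" if "y \<in> {x0 1..x0 2}" for y
    unfolding W_def by (rule integral_has_real_derivative[OF wcont that])
  then have Wcont: "continuous_on {x0 1..x0 2} W"
    by (rule DERIV_continuous_on)
  let ?E = "\<lambda>t. W (X 1 t) + W (X 2 t)"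
  have contE: "continuous_on {0..} ?E"
    by (intro continuous_on_add continuous_on_compose2[OF Wcont] cbo_solution_continuous[OF sol])
      (use range in auto)
  have derE: "(?E has_real_derivative 0) (at t)" if "t > 0" for t
  proof -
    have interior: "at t within {0<..} = at t"
      using that by (intro at_within_interior) (auto simp: interior_open)
    \<comment> \<open>The antiderivative is only differentiable relative to the initial interval, which the
      particles never leave.\<close>
    have chain: "((\<lambda>s. W (X i s)) has_real_derivative w (X i t) * D) (at t)"
      if "i \<in> {1, 2}" and D: "(X i has_real_derivative D) (at t)" for i D
    proof -
      have "X i ` {0<..} \<subseteq> {x0 1..x0 2}"
        using range that(1) by (auto simp: less_imp_le)
      moreover have "X i t \<in> {x0 1..x0 2}" using range \<open>t > 0\<close> that(1) by auto
      ultimately have "(W has_real_derivative w (X i t)) (at (X i t) within X i ` {0<..})"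
        using Wder DERIV_subset by blast
      moreover have "(X i has_real_derivative D) (at t within {0<..})"
        using D by (rule has_field_derivative_at_within)
      ultimately have "(W \<circ> X i has_real_derivative w (X i t) * D) (at t within {0<..})"
        by (rule DERIV_image_chain)
      then show ?thesis by (simp add: interior o_def)
    qed
    show ?thesis
      using DERIV_add[OF chain[OF _ cbo_two_particle_velocities(1)[OF sol that]]
          chain[OF _ cbo_two_particle_velocities(2)[OF sol that]]]
      by (simp add: w_def mult_ac)
  qed
  have const: "?E t = W (x0 2)" if "t \<ge> 0" for t
  proof (cases "t = 0")
    case True
    then show ?thesis by (simp add: init W_def del: One_nat_def)
  next
    case False
    have "continuous_on {0..t} ?E" by (rule continuous_on_subset[OF contE]) auto
    then have "?E t = ?E 0"
      using DERIV_isconst_end[of 0 t ?E] derE that False by auto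
    then show ?thesis by (simp add: init W_def del: One_nat_def)
  qed
  have limW: "((\<lambda>t. W (X i t)) \<longlongrightarrow> W m) at_top" if "i \<in> {1, 2}" for i
    by (rule continuous_on_tendsto_compose[OF Wcont _ m])
      (use that lim range in \<open>auto intro!: eventually_mono[OF eventually_ge_at_top[of 0]]\<close>)
  have "(?E \<longlongrightarrow> W m + W m) at_top"
    by (intro tendsto_add limW) auto
  moreover have "(?E \<longlongrightarrow> W (x0 2)) at_top"
    by (rule tendsto_eventually)
      (use const in \<open>auto intro!: eventually_mono[OF eventually_ge_at_top[of 0]]\<close>)
  ultimately have "W m + W m = W (x0 2)"
    by (rule tendsto_unique[OF trivial_limit_at_top_linorder])
  moreover have "W m + integral {m..x0 2} w = W (x0 2)"
    unfolding W_def using m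
    by (intro Henstock_Kurzweil_Integration.integral_combine integrable_continuous_real wcont) auto
  ultimately show ?thesis by (simp add: W_def w_def)
qed

section \<open>Locating the median of a concentrated weight\<close>

text \<open>The mass to the right of \<open>m\<close> is at most the integral of \<open>C / (x - c)\<^sup>2\<close> from \<open>m\<close> to \<open>\<infinity>\<close>,
  which is \<open>C / (m - c)\<close>; the mass to the left of \<open>m > c\<close> is at least \<open>r * B\<close>.\<close>

lemma median_upper_bound:
  fixes w :: "real \<Rightarrow> real"
  assumes cont: "continuous_on {p..q} w" and nonneg: "\<And>x. x \<in> {p..q} \<Longrightarrow> 0 \<le> w x"
    and r: "r > 0" "p \<le> c - r" and B: "B > 0"
    and lower: "\<And>x. x \<in> {c - r..c} \<Longrightarrow> B \<le> w x"
    and upper: "\<And>x. c < x \<Longrightarrow> x \<le> q \<Longrightarrow> w x \<le> C / (x - c)\<^sup>2" and C: "C \<ge> 0"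
    and m: "m \<in> {p..q}" and median: "integral {p..m} w = integral {m..q} w"
  shows "m - c \<le> C / (r * B)"
proof (cases "m \<le> c")
  case True
  moreover have "0 \<le> C / (r * B)" using r B C by simp
  ultimately show ?thesis by linarith
next
  case False
  have int: "w integrable_on {u..v}" if "p \<le> u" "v \<le> q" for u v
    by (rule integrable_continuous_real, rule continuous_on_subset[OF cont]) (use that in auto)
  have "r * B = integral {c - r..c} (\<lambda>x. B)"
    using r by simp
  also have "\<dots> \<le> integral {c - r..c} w"
    using lower False m r by (intro integral_le int) auto
  also have "\<dots> \<le> integral {p..m} w"
    using False m r nonneg by (intro integral_subset_le int) auto
  also have "\<dots> = integral {m..q} w" by (fact median)
  also have "\<dots> \<le> C / (m - c) - C / (q - c)"
  proof (rule has_integral_le)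
    show "(w has_integral integral {m..q} w) {m..q}"
      using m int by (intro integrable_integral) auto
    have "((\<lambda>x. C / (x - c)\<^sup>2) has_integral (- C / (q - c)) - (- C / (m - c))) {m..q}"
      using m False
      by (intro fundamental_theorem_of_calculus)
        (auto simp: has_real_derivative_iff_has_vector_derivative[symmetric] power2_eq_square
          intro!: derivative_eq_intros)
    then show "((\<lambda>x. C / (x - c)\<^sup>2) has_integral C / (m - c) - C / (q - c)) {m..q}" by simp
  qed (use upper False in auto)
  also have "\<dots> \<le> C / (m - c)" using C m False by simp
  finally show ?thesis using False r B by (simp add: field_simps)
qed

lemma median_lower_bound:
  fixes w :: "real \<Rightarrow> real"
  assumes cont: "continuous_on {p..q} w" and nonneg: "\<And>x. x \<in> {p..q} \<Longrightarrow> 0 \<le> w x"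
    and r: "r > 0" "c + r \<le> q" and B: "B > 0"
    and lower: "\<And>x. x \<in> {c..c + r} \<Longrightarrow> B \<le> w x"
    and upper: "\<And>x. x < c \<Longrightarrow> p \<le> x \<Longrightarrow> w x \<le> C / (x - c)\<^sup>2" and C: "C \<ge> 0"
    and m: "m \<in> {p..q}" and median: "integral {p..m} w = integral {m..q} w"
  shows "c - m \<le> C / (r * B)"
proof -
  have "(- m) - (- c) \<le> C / (r * B)"
  proof (rule median_upper_bound[where w = "\<lambda>x. w (- x)" and p = "- q" and q = "- p"])
    show "continuous_on {- q..- p} (\<lambda>x. w (- x))"
      by (rule continuous_on_compose2[OF cont]) (auto intro!: continuous_intros)
    show "w (- x) \<le> C / (x - - c)\<^sup>2" if "- c < x" "x \<le> - p" for x
      using upper[of "- x"] that by (simp add: power2_eq_square algebra_simps)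
    show "integral {- q..- m} (\<lambda>x. w (- x)) = integral {- m..- p} (\<lambda>x. w (- x))"
      by (simp add: integral_reflect_real median)
  qed (use assms in auto)
  then show ?thesis by simp
qed

section \<open>Quadratic growth at a nondegenerate minimiser\<close>

text \<open>Peano's form of Taylor's formula: apply the mean value theorem to the remainder, whose
  derivative is at most \<open>e * \<bar>y - c\<bar>\<close> because \<open>f'\<close> is differentiable at \<open>c\<close>.\<close>

lemma second_order_taylor:
  fixes f f' :: "real \<Rightarrow> real"
  assumes S: "open S" "c \<in> S" and der: "\<And>y. y \<in> S \<Longrightarrow> (f has_real_derivative f' y) (at y)"
    and der2: "(f' has_real_derivative A) (at c)" and crit: "f' c = 0" and e: "e > 0"
  obtains d where "d > 0"
    "\<And>x. \<bar>x - c\<bar> \<le> d \<Longrightarrow> x \<in> S \<and> \<bar>f x - f c - A / 2 * (x - c)\<^sup>2\<bar> \<le> e * (x - c)\<^sup>2"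
proof -
  obtain d1 where d1: "d1 > 0" "cball c d1 \<subseteq> S"
    using S open_contains_cball by blast
  have "(f' has_derivative (\<lambda>h. A * h)) (at c)"
    using der2 by (simp add: has_field_derivative_def)
  then obtain d2 where d2: "d2 > 0"
      "\<And>y. \<bar>y - c\<bar> < d2 \<Longrightarrow> \<bar>f' y - A * (y - c)\<bar> \<le> e * \<bar>y - c\<bar>"
    using e crit unfolding has_derivative_at_alt by fastforce
  define d where "d = min d1 (d2 / 2)"
  have d: "d > 0" "d \<le> d1" "d < d2" using d1 d2 by (auto simp: d_def)
  show thesis
  proof (rule that[OF d(1)])
    fix x assume x: "\<bar>x - c\<bar> \<le> d"
    let ?g = "\<lambda>y. f y - A / 2 * (y - c)\<^sup>2"
    have near: "y \<in> S" "\<bar>f' y - A * (y - c)\<bar> \<le> e * \<bar>x - c\<bar>" if "\<bar>y - c\<bar> \<le> \<bar>x - c\<bar>" for y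
    proof -
      show "y \<in> S" using that x d d1(2) by (force simp: dist_real_def)
      have "e * \<bar>y - c\<bar> \<le> e * \<bar>x - c\<bar>" using that e by simp
      then show "\<bar>f' y - A * (y - c)\<bar> \<le> e * \<bar>x - c\<bar>" using d2(2)[of y] that x d by linarith
    qed
    have "norm (?g x - ?g c) \<le> (e * \<bar>x - c\<bar>) * norm (x - c)"
    proof (rule field_differentiable_bound[where S = "cball c \<bar>x - c\<bar>"
          and f' = "\<lambda>y. f' y - A * (y - c)"])
      fix y assume "y \<in> cball c \<bar>x - c\<bar>"
      then have y: "\<bar>y - c\<bar> \<le> \<bar>x - c\<bar>" by (simp add: dist_real_def abs_minus_commute)
      have "(?g has_real_derivative f' y - A * (y - c)) (at y)"
        using der[OF near(1)[OF y]] by (auto intro!: derivative_eq_intros)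
      then show "(?g has_real_derivative f' y - A * (y - c)) (at y within cball c \<bar>x - c\<bar>)"
        by (rule has_field_derivative_at_within)
      show "norm (f' y - A * (y - c)) \<le> e * \<bar>x - c\<bar>" using near(2)[OF y] by simp
    qed (auto simp: dist_real_def)
    then show "x \<in> S \<and> \<bar>f x - f c - A / 2 * (x - c)\<^sup>2\<bar> \<le> e * (x - c)\<^sup>2"
      using near(1)[of x] by (simp add: power2_eq_square algebra_simps)
  qed
qed

text \<open>Near \<open>c\<close> both bounds come from Taylor's formula, with the error term chosen as half of
  the main term; minimality rules out a negative second derivative. Away from \<open>c\<close>, compactness and
  uniqueness of the minimiser keep \<open>f - f c\<close> above a positive constant, which is a multiple of
  \<open>(x - c)\<^sup>2\<close> on a bounded interval.\<close>

lemma quadratic_growth: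
  fixes f :: "real \<Rightarrow> real"
  assumes C2: "C2_on {a<..<b} f" and cont: "continuous_on {a..b} f" and c: "c \<in> {a<..<b}"
    and min: "\<And>x. x \<in> {a..b} \<Longrightarrow> x \<noteq> c \<Longrightarrow> f c < f x"
    and crit: "deriv f c = 0" and nondeg: "deriv (deriv f) c \<noteq> 0"
  obtains k K d where "k > 0" "d > 0"
    "\<And>x. x \<in> {a..b} \<Longrightarrow> k * (x - c)\<^sup>2 \<le> f x - f c"
    "\<And>x. \<bar>x - c\<bar> \<le> d \<Longrightarrow> f x - f c \<le> K * (x - c)\<^sup>2"
proof -
  define A where "A = deriv (deriv f) c"
  have real_der: "(g has_real_derivative deriv g y) (at y)"
    if "g differentiable_on {a<..<b}" "y \<in> {a<..<b}" for g :: "real \<Rightarrow> real" and y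
    using that differentiable_on_eq_differentiable_at[of "{a<..<b}" g]
    by (simp add: DERIV_deriv_iff_real_differentiable)
  have "f differentiable_on {a<..<b}" "deriv f differentiable_on {a<..<b}"
    using C2 by (auto simp: C2_on_def)
  then obtain d where d: "d > 0"
    "\<And>x. \<bar>x - c\<bar> \<le> d \<Longrightarrow>
      x \<in> {a<..<b} \<and> \<bar>f x - f c - A / 2 * (x - c)\<^sup>2\<bar> \<le> \<bar>A\<bar> / 4 * (x - c)\<^sup>2"
    using second_order_taylor[of "{a<..<b}" c f "deriv f" A "\<bar>A\<bar> / 4"] real_der c crit nondeg
    unfolding A_def by auto
  have "A > 0"
  proof (rule ccontr)
    assume "\<not> A > 0"
    then have A: "A < 0" using nondeg by (simp add: A_def)
    have "f (c + d) - f c \<le> A / 4 * d\<^sup>2"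
      using d(2)[of "c + d"] d(1) A by (simp add: abs_le_iff)
    also have "\<dots> < 0" using A d(1) by (simp add: mult_neg_pos)
    finally show False using min[of "c + d"] d(1) d(2)[of "c + d"] by simp
  qed
  have low: "A / 4 * (x - c)\<^sup>2 \<le> f x - f c" and up: "f x - f c \<le> 3 * A / 4 * (x - c)\<^sup>2"
    if "\<bar>x - c\<bar> \<le> d" for x
  proof -
    have "\<bar>f x - f c - A / 2 * (x - c)\<^sup>2\<bar> \<le> A / 4 * (x - c)\<^sup>2"
      using d(2)[OF that] \<open>A > 0\<close> by simp
    then show "A / 4 * (x - c)\<^sup>2 \<le> f x - f c" "f x - f c \<le> 3 * A / 4 * (x - c)\<^sup>2"
      by linarith+
  qed
  obtain \<eta> where \<eta>: "\<eta> > 0" "\<And>x. x \<in> {a..b} \<Longrightarrow> d < \<bar>x - c\<bar> \<Longrightarrow> \<eta> \<le> f x - f c"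
  proof -
    let ?S = "{a..b} - ball c d"
    have comp: "compact ?S" by (intro compact_diff compact_Icc open_ball)
    have "continuous_on ?S f" by (rule continuous_on_subset[OF cont]) auto
    show thesis
    proof (cases "?S = {}")
      case True
      then show thesis using that[of 1] by (force simp: dist_real_def abs_minus_commute)
    next
      case False
      then obtain y where "y \<in> ?S" "\<And>x. x \<in> ?S \<Longrightarrow> f y \<le> f x"
        using continuous_attains_inf[OF comp False \<open>continuous_on ?S f\<close>] by metis
      then show thesis
        using that[of "f y - f c"] min[of y] d(1)
        by (force simp: dist_real_def abs_minus_commute)
    qed
  qed
  define k where "k = min (A / 4) (\<eta> / (b - a)\<^sup>2)"
  have ab: "a < b" using c by simp
  have k: "k > 0" "k \<le> A / 4" "k \<le> \<eta> / (b - a)\<^sup>2"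
    using \<open>A > 0\<close> \<eta>(1) ab unfolding k_def
    by (simp, intro min.cobounded1, intro min.cobounded2)
  have "k * (x - c)\<^sup>2 \<le> f x - f c" if x: "x \<in> {a..b}" for x
  proof (cases "\<bar>x - c\<bar> \<le> d")
    case True
    then show ?thesis using low[OF True] mult_right_mono[OF k(2), of "(x - c)\<^sup>2"] by simp
  next
    case False
    have "\<bar>x - c\<bar> \<le> \<bar>b - a\<bar>" using x c by auto
    then have "(x - c)\<^sup>2 \<le> (b - a)\<^sup>2" by (simp add: abs_le_square_iff)
    then have "k * (x - c)\<^sup>2 \<le> \<eta> / (b - a)\<^sup>2 * (b - a)\<^sup>2"
      using k \<eta>(1) by (intro mult_mono) auto
    also have "\<dots> = \<eta>" using ab by simp
    also have "\<dots> \<le> f x - f c" using \<eta>(2)[OF x] False by simp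
    finally show ?thesis .
  qed
  then show thesis using that[OF k(1) d(1) _ up] by blast
qed

section \<open>Concentration of the consensus point\<close>

text \<open>The scale \<open>r = 1 / sqrt \<alpha>\<close> is the width on which \<open>w\<close> is comparable with its maximum
  \<open>exp (- \<alpha> f c)\<close>; this factor cancels in the quotient \<open>C / (r * B)\<close> of the median bounds.\<close>

lemma gibbs_median_concentration:
  fixes f :: "real \<Rightarrow> real"
  assumes cont: "continuous_on {p..q} f" and \<alpha>: "\<alpha> > 0" and k: "k > 0"
    and growth: "\<And>x. x \<in> {p..q} \<Longrightarrow> k * (x - c)\<^sup>2 \<le> f x - f c"
    and flat: "\<And>x. \<bar>x - c\<bar> \<le> 1 / sqrt \<alpha> \<Longrightarrow> f x - f c \<le> K * (x - c)\<^sup>2"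
    and K: "K \<ge> 0"
    and room: "p \<le> c - 1 / sqrt \<alpha>" "c + 1 / sqrt \<alpha> \<le> q"
    and m: "m \<in> {p..q}"
    and median: "integral {p..m} (cbo_weight f \<alpha>) = integral {m..q} (cbo_weight f \<alpha>)"
  shows "\<bar>m - c\<bar> \<le> exp K / k / sqrt \<alpha>"
proof -
  define w where "w = cbo_weight f \<alpha>"
  define M where "M = exp (- \<alpha> * f c)"
  define r where "r = 1 / sqrt \<alpha>"
  have w: "w x = M * exp (- (\<alpha> * (f x - f c)))" for x
    by (simp add: w_def cbo_weight_def M_def exp_add[symmetric] algebra_simps)
  have M: "M > 0" and r: "r > 0" "\<alpha> * r\<^sup>2 = 1"
    using \<alpha> by (simp_all add: M_def r_def power_divide)
  have wcont: "continuous_on {p..q} w"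
    unfolding w_def cbo_weight_def[abs_def] by (intro continuous_intros cont)
  have lower: "M * exp (- K) \<le> w x" if "\<bar>x - c\<bar> \<le> r" for x
  proof -
    have "(x - c)\<^sup>2 \<le> r\<^sup>2" using that r by (simp add: abs_le_square_iff[symmetric])
    then have "K * (x - c)\<^sup>2 \<le> K * r\<^sup>2" using K by (rule mult_left_mono)
    then have "f x - f c \<le> K * r\<^sup>2" using flat[of x] that by (simp add: r_def)
    then have "\<alpha> * (f x - f c) \<le> \<alpha> * (K * r\<^sup>2)" using \<alpha> by simp
    also have "\<dots> = K" using r(2) by (simp add: mult.left_commute)
    finally show ?thesis using M by (simp add: w)
  qed
  have upper: "w x \<le> M / (\<alpha> * k) / (x - c)\<^sup>2" if "x \<in> {p..q}" "x \<noteq> c" for x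
  proof -
    define u where "u = \<alpha> * k * (x - c)\<^sup>2"
    have u: "u > 0" using that \<alpha> k by (simp add: u_def)
    have "u \<le> \<alpha> * (f x - f c)" using growth[OF that(1)] \<alpha> by (simp add: u_def mult.assoc)
    then have "w x \<le> M * exp (- u)" using M by (simp add: w)
    also have "\<dots> \<le> M * (1 / u)"
    proof (rule mult_left_mono)
      have "u \<le> exp u" using exp_ge_add_one_self[of u] by linarith
      then show "exp (- u) \<le> 1 / u" using u by (simp add: exp_minus field_simps)
    qed (use M in simp)
    also have "\<dots> = M / (\<alpha> * k) / (x - c)\<^sup>2" by (simp add: u_def)
    finally show ?thesis .
  qed
  have bound: "M / (\<alpha> * k) / (r * (M * exp (- K))) = exp K / k / sqrt \<alpha>"
    using M k \<alpha> by (simp add: r_def exp_minus field_simps)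
  have nonneg: "0 \<le> w x" for x using M by (simp add: w)
  have room': "p \<le> c - r" "c + r \<le> q" using room by (simp_all add: r_def)
  have "m - c \<le> M / (\<alpha> * k) / (r * (M * exp (- K)))"
    by (rule median_upper_bound[OF wcont nonneg r(1) _ _ lower upper _ m])
      (use room' r(1) M \<alpha> k median in \<open>auto simp: w_def\<close>)
  moreover have "c - m \<le> M / (\<alpha> * k) / (r * (M * exp (- K)))"
    by (rule median_lower_bound[OF wcont nonneg r(1) _ _ lower upper _ m])
      (use room' r(1) M \<alpha> k median in \<open>auto simp: w_def\<close>)
  ultimately show ?thesis unfolding bound by linarith
qed

theorem theorem1p1:
  fixes a b lam x_star :: real
    and f :: "real \<Rightarrow> real"
    and x0 :: "nat \<Rightarrow> real"
    and X :: "real \<Rightarrow> nat \<Rightarrow> real \<Rightarrow> real"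
  assumes "a < b"
    and "\<And>x. 0 \<le> f x"
    and "C2_on {a<..<b} f"
    and "continuous_on {a..b} f"
    and "x_star \<in> {a<..<b}"
    and "\<And>x. is_arg_min f (\<lambda>y. y \<in> {a..b}) x \<longleftrightarrow> x = x_star"
    and "deriv f x_star = 0"
    and "deriv (deriv f) x_star \<noteq> 0"
    and "lam > 0"
    and "x_star \<in> {x0 1<..<x0 2}"
    and "{x0 1<..<x0 2} \<subseteq> {a..b}"
    and "\<And>\<alpha>. \<alpha> > 0 \<Longrightarrow> cbo_solution lam \<alpha> f 2 x0 (X \<alpha>)"
  shows "\<exists>x_inf :: real \<Rightarrow> real.
           (\<forall>\<alpha>>0. (X \<alpha> 1 \<longlongrightarrow> x_inf \<alpha>) at_top \<and> (X \<alpha> 2 \<longlongrightarrow> x_inf \<alpha>) at_top) \<and>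
           (\<exists>\<alpha>1>0. \<exists>c>0. \<forall>\<alpha>>\<alpha>1. \<bar>x_inf \<alpha> - x_star\<bar> \<le> c / sqrt \<alpha>)"
proof -
  define p q where pq: "p = x0 1" "q = x0 2"
  have star: "p < x_star" "x_star < q" using assms(10) by (auto simp: pq)
  then have less: "x0 1 < x0 2" by (simp add: pq)
  have "closure {x0 1<..<x0 2} \<subseteq> {a..b}"
    using assms(11) by (intro closure_minimal) auto
  then have sub: "{p..q} \<subseteq> {a..b}" using less by (simp add: pq)
  have cont: "continuous_on {p..q} f" using assms(4) sub by (rule continuous_on_subset)
  have min: "f x_star < f x" if x: "x \<in> {a..b}" "x \<noteq> x_star" for x
  proof -
    have "is_arg_min f (\<lambda>y. y \<in> {a..b}) x_star" using assms(6) by simp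
    then have le: "f x_star \<le> f y" if "y \<in> {a..b}" for y
      using that by (auto simp: is_arg_min_linorder)
    have "\<not> is_arg_min f (\<lambda>y. y \<in> {a..b}) x" using assms(6) x(2) by simp
    then obtain y where "y \<in> {a..b}" "f y < f x" using x(1) by (auto simp: is_arg_min_def)
    then show ?thesis using le by fastforce
  qed
  obtain k K d where kK: "k > 0" "d > 0"
    "\<And>x. x \<in> {a..b} \<Longrightarrow> k * (x - x_star)\<^sup>2 \<le> f x - f x_star"
    "\<And>x. \<bar>x - x_star\<bar> \<le> d \<Longrightarrow> f x - f x_star \<le> K * (x - x_star)\<^sup>2"
    using quadratic_growth[OF assms(3,4,5) min assms(7,8)] by metis
  have "\<exists>y. (X \<alpha> 1 \<longlongrightarrow> y) at_top \<and> (X \<alpha> 2 \<longlongrightarrow> y) at_top \<and> y \<in> {p..q}" if "\<alpha> > 0" for \<alpha>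
    using cbo_two_particle_consensus[OF assms(12)[OF that] assms(9) less] unfolding pq by metis
  then obtain m where m: "\<And>\<alpha>. \<alpha> > 0 \<Longrightarrow> (X \<alpha> 1 \<longlongrightarrow> m \<alpha>) at_top"
    "\<And>\<alpha>. \<alpha> > 0 \<Longrightarrow> (X \<alpha> 2 \<longlongrightarrow> m \<alpha>) at_top" "\<And>\<alpha>. \<alpha> > 0 \<Longrightarrow> m \<alpha> \<in> {p..q}"
    by metis
  \<comment> \<open>For \<open>\<alpha> > 1 / \<rho>\<^sup>2\<close> the window of half-width \<open>1 / sqrt \<alpha>\<close> lies in the initial interval
    and in the region where the Taylor bound holds.\<close>
  define \<rho> where "\<rho> = min d (min (x_star - p) (q - x_star))"
  have \<rho>: "\<rho> > 0" "\<rho> \<le> d" "\<rho> \<le> x_star - p" "\<rho> \<le> q - x_star"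
    using kK(2) star by (auto simp: \<rho>_def)
  have bound: "\<bar>m \<alpha> - x_star\<bar> \<le> exp (max K 0) / k / sqrt \<alpha>" if \<alpha>: "\<alpha> > 1 / \<rho>\<^sup>2" for \<alpha>
  proof -
    have pos: "\<alpha> > 0" using \<alpha> \<rho>(1) by (meson less_trans zero_less_divide_1_iff zero_less_power)
    have "sqrt (1 / \<rho>\<^sup>2) < sqrt \<alpha>" using \<alpha> by simp
    then have "1 / \<rho> < sqrt \<alpha>" using \<rho>(1) by (simp add: real_sqrt_divide)
    then have small: "1 / sqrt \<alpha> \<le> \<rho>" using pos \<rho>(1) by (simp add: field_simps)
    show ?thesis
    proof (rule gibbs_median_concentration[where f = f and p = p and q = q, OF cont pos kK(1)])
      fix x assume "\<bar>x - x_star\<bar> \<le> 1 / sqrt \<alpha>"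
      then have "f x - f x_star \<le> K * (x - x_star)\<^sup>2" using small \<rho> by (intro kK(4)) simp
      also have "\<dots> \<le> max K 0 * (x - x_star)\<^sup>2" by (intro mult_right_mono) auto
      finally show "f x - f x_star \<le> max K 0 * (x - x_star)\<^sup>2" .
    next
      show "integral {p..m \<alpha>} (cbo_weight f \<alpha>) = integral {m \<alpha>..q} (cbo_weight f \<alpha>)"
        using consensus_at_gibbs_median[OF assms(12)[OF pos] assms(9) less] m[OF pos] cont
        by (simp add: pq)
    qed (use kK(3) sub small \<rho> m(3)[OF pos] in auto)
  qed
  show ?thesis
  proof (intro exI[of _ m] conjI)
    show "\<forall>\<alpha>>0. (X \<alpha> 1 \<longlongrightarrow> m \<alpha>) at_top \<and> (X \<alpha> 2 \<longlongrightarrow> m \<alpha>) at_top" using m by blast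
    have "1 / \<rho>\<^sup>2 > 0" "exp (max K 0) / k > 0" using \<rho>(1) kK(1) by auto
    then show "\<exists>\<alpha>1>0. \<exists>c>0. \<forall>\<alpha>>\<alpha>1. \<bar>m \<alpha> - x_star\<bar> \<le> c / sqrt \<alpha>" using bound by blast
  qed
qed

end
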